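(* Let $M$ be a matroid on a finite ground set $E$ with collection of bases $\mathcal{B}$, let $M^\ast$ be its dual matroid with collection of independent sets $\mathcal{I}^\ast$, and let $\preceq$ be a total order on $E$. Then the BDD $\mathsf{B}(\mathcal{I}^\ast)$ with respect to $(E,\preceq)$ is obtained from the ZDD $\mathsf{Z}(\mathcal{B})$ with respect to $(E,\preceq)$ by setting $(\nu_0,\nu_1)\gets(\nu_1,\nu_0)$ (swapping the 0-arc and 1-arc) at every non-terminal node $\nu$.
   Context: The dual $M^\ast$ of $M$ has ground set $E$ and bases $\{E\setminus B: B\in\mathcal{B}\}$. A decision diagram over $(E,\preceq)$ is a directed acyclic graph with a unique root, at most two terminal nodes, the 0-terminal $\bot$ and the 1-terminal $\top$, and non-terminal nodes $\nu$, each with a label $\ell(\nu)\in E$ and exactly two outgoing arcs, the 0-arc $(\nu,\nu_0)$ and the 1-arc $(\nu,\nu_1)$, with $\ell(\nu)\prec\ell(\nu_0),\ell(\nu_1)$ (terminal labels regarded as larger than all elements of $E$). A 1-path is a directed path from the root to $\top$. Under BDD semantics a 1-path represents all $X\subseteq E$ containing the label of the tail of every 1-arc on the path and no label of the tail of any 0-arc on the path; under ZDD semantics it represents the single set of labels of tails of the 1-arcs on the path; the diagram represents the union. The BDD $\mathsf{B}(\mathcal{S})$ (resp. ZDD $\mathsf{Z}(\mathcal{S})$) of $\mathcal{S}\subseteq 2^E$ is the unique diagram obtained from the complete binary decision tree of $\mathcal{S}$ (internal nodes at depth $j$ labeled by the $(j+1)$-th smallest element of $E$; the leaf reached by taking 1-arcs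 exactly at the elements of $X$ is $\top$ iff $X\in\mathcal{S}$, else $\bot$) by exhaustively applying: (NS) merge non-terminal nodes with the same label, same 0-successor and same 1-successor; and for BDDs (B-ND) remove every non-terminal $\nu$ with $\nu_0=\nu_1$, redirecting arcs entering $\nu$ to $\nu_0$; for ZDDs (Z-ND) remove every non-terminal $\nu$ with $\nu_1=\bot$, redirecting arcs entering $\nu$ to $\nu_0$. *)

theory Defs
  imports Main
begin

section \<open>Matroids and their duals\<close>

locale matroid =
  fixes E :: "'a set" and \<B> :: "'a set set"
  assumes finite_ground: "finite E"
    and bases_subset: "\<B> \<subseteq> Pow E"
    and bases_nonempty: "\<B> \<noteq> {}"
    and basis_exchange:
      "\<lbrakk>B1 \<in> \<B>; B2 \<in> \<B>; x \<in> B1 - B2\<rbrakk> \<Longrightarrow> \<exists>y \<in> B2 - B1. insert y (B1 - {x}) \<in> \<B>"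

definition indep_sets :: "'a set set \<Rightarrow> 'a set set" where
  "indep_sets \<B> = {I. \<exists>B \<in> \<B>. I \<subseteq> B}"

definition dual_bases :: "'a set \<Rightarrow> 'a set set \<Rightarrow> 'a set set" where
  "dual_bases E \<B> = {E - B | B. B \<in> \<B>}"

section \<open>Decision diagrams\<close>

datatype 'v node = Bot | Top | Inner 'v

text \<open>
  The field \<open>inner\<close> is the set of non-terminal nodes. A terminal belongs to a diagram iff it is
  the root or a successor of a non-terminal node, so a terminal that loses its last incoming arc
  during a reduction disappears. The fields \<open>lbl\<close>, \<open>succ0\<close> and \<open>succ1\<close> are meaningful on \<open>inner\<close> only.
\<close>

record ('v, 'a) diagram =
  inner :: "'v set"
  start :: "'v node"
  lbl :: "'v \<Rightarrow> 'a"
  succ0 :: "'v \<Rightarrow> 'v node"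
  succ1 :: "'v \<Rightarrow> 'v node"

text \<open>Isomorphism of labelled diagrams; terminals are mapped to themselves by \<open>map_node\<close>.\<close>

definition diagram_iso :: "('v, 'a) diagram \<Rightarrow> ('w, 'a) diagram \<Rightarrow> bool" (infix "\<simeq>" 50) where
  "D \<simeq> D' \<longleftrightarrow> (\<exists>f. bij_betw f (inner D) (inner D') \<and>
     start D' = map_node f (start D) \<and>
     (\<forall>v \<in> inner D. lbl D' (f v) = lbl D v \<and>
        succ0 D' (f v) = map_node f (succ0 D v) \<and>
        succ1 D' (f v) = map_node f (succ1 D v)))"

definition swap_arcs :: "('v, 'a) diagram \<Rightarrow> ('v, 'a) diagram" where
  "swap_arcs D = D\<lparr>succ0 := succ1 D, succ1 := succ0 D\<rparr>"

section \<open>The complete binary decision tree\<close>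

text \<open>The element of \<open>E\<close> with exactly \<open>j\<close> strictly smaller elements; \<open>j\<close> counts from \<open>0\<close>.\<close>

definition nth_smallest :: "'a set \<Rightarrow> 'a rel \<Rightarrow> nat \<Rightarrow> 'a" where
  "nth_smallest E r j = (THE e. e \<in> E \<and> card {x \<in> E. (x, e) \<in> r \<and> x \<noteq> e} = j)"

text \<open>
  A node of the tree is the list of arcs (\<open>True\<close> for a 1-arc) leading to it from the root; the
  lists of length \<open>card E\<close> are the leaves, which are identified with the two terminals.
\<close>

definition path_set :: "'a set \<Rightarrow> 'a rel \<Rightarrow> bool list \<Rightarrow> 'a set" where
  "path_set E r p = {nth_smallest E r j | j. j < length p \<and> p ! j}"

definition tree_node :: "'a set \<Rightarrow> 'a rel \<Rightarrow> 'a set set \<Rightarrow> bool list \<Rightarrow> bool list node" where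
  "tree_node E r S p =
     (if length p < card E then Inner p else if path_set E r p \<in> S then Top else Bot)"

definition decision_tree :: "'a set \<Rightarrow> 'a rel \<Rightarrow> 'a set set \<Rightarrow> (bool list, 'a) diagram" where
  "decision_tree E r S =
     \<lparr>inner = {p. length p < card E},
      start = tree_node E r S [],
      lbl = (\<lambda>p. nth_smallest E r (length p)),
      succ0 = (\<lambda>p. tree_node E r S (p @ [False])),
      succ1 = (\<lambda>p. tree_node E r S (p @ [True]))\<rparr>"

section \<open>Reduction\<close>

text \<open>Delete \<open>v\<close> and redirect all arcs entering it (and the root pointer) to \<open>w\<close>.\<close>

definition replace_node :: "'v \<Rightarrow> 'v node \<Rightarrow> ('v, 'a) diagram \<Rightarrow> ('v, 'a) diagram" where
  "replace_node v w D =
     (let \<sigma> = (\<lambda>x. if x = Inner v then w else x)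
      in D\<lparr>inner := inner D - {v}, start := \<sigma> (start D),
           succ0 := \<sigma> \<circ> succ0 D, succ1 := \<sigma> \<circ> succ1 D\<rparr>)"

inductive ns_step :: "('v, 'a) diagram \<Rightarrow> ('v, 'a) diagram \<Rightarrow> bool" where
  "\<lbrakk>u \<in> inner D; v \<in> inner D; u \<noteq> v; lbl D u = lbl D v;
    succ0 D u = succ0 D v; succ1 D u = succ1 D v\<rbrakk>
   \<Longrightarrow> ns_step D (replace_node v (Inner u) D)"

inductive bnd_step :: "('v, 'a) diagram \<Rightarrow> ('v, 'a) diagram \<Rightarrow> bool" where
  "\<lbrakk>v \<in> inner D; succ0 D v = succ1 D v\<rbrakk> \<Longrightarrow> bnd_step D (replace_node v (succ0 D v) D)"

inductive znd_step :: "('v, 'a) diagram \<Rightarrow> ('v, 'a) diagram \<Rightarrow> bool" where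
  "\<lbrakk>v \<in> inner D; succ1 D v = Bot\<rbrakk> \<Longrightarrow> znd_step D (replace_node v (succ0 D v) D)"

definition bdd_step :: "('v, 'a) diagram \<Rightarrow> ('v, 'a) diagram \<Rightarrow> bool" where
  "bdd_step D D' \<longleftrightarrow> ns_step D D' \<or> bnd_step D D'"

definition zdd_step :: "('v, 'a) diagram \<Rightarrow> ('v, 'a) diagram \<Rightarrow> bool" where
  "zdd_step D D' \<longleftrightarrow> ns_step D D' \<or> znd_step D D'"

definition exhausts_to :: "('d \<Rightarrow> 'd \<Rightarrow> bool) \<Rightarrow> 'd \<Rightarrow> 'd \<Rightarrow> bool" where
  "exhausts_to step D D' \<longleftrightarrow> step\<^sup>*\<^sup>* D D' \<and> (\<nexists>D''. step D' D'')"

text \<open>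
  Different reduction orders retain different representatives of merged nodes, so the result is
  unique only up to \<open>\<simeq>\<close>; the choice operator picks one of the results.
\<close>

definition BDD :: "'a set \<Rightarrow> 'a rel \<Rightarrow> 'a set set \<Rightarrow> (bool list, 'a) diagram" where
  "BDD E r S = (SOME D. exhausts_to bdd_step (decision_tree E r S) D)"

definition ZDD :: "'a set \<Rightarrow> 'a rel \<Rightarrow> 'a set set \<Rightarrow> (bool list, 'a) diagram" where
  "ZDD E r S = (SOME D. exhausts_to zdd_step (decision_tree E r S) D)"

lemma exhausts_to_exists:
  fixes D :: "('v, 'a) diagram"
  assumes fin: "finite (inner D)"
    and step: "\<And>D D'. step D D' \<Longrightarrow> \<exists>v \<in> inner D. inner D' = inner D - {v}"
  shows "\<exists>D'. exhausts_to step D D'"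
  using fin
proof (induction "card (inner D)" arbitrary: D rule: less_induct)
  case less
  show ?case
  proof (cases "\<exists>D1. step D D1")
    case True
    then obtain D1 where D1: "step D D1" by blast
    from step[OF D1] obtain v where v: "v \<in> inner D" "inner D1 = inner D - {v}" ..
    have "card (inner D1) < card (inner D)"
      unfolding v(2) using less.prems v(1) by (rule card_Diff1_less)
    moreover have "finite (inner D1)"
      unfolding v(2) using less.prems by (rule finite_Diff)
    ultimately obtain D' where "exhausts_to step D1 D'" using less.hyps by blast
    then have "exhausts_to step D D'"
      using converse_rtranclp_into_rtranclp[of step, OF D1] by (simp add: exhausts_to_def)
    then show ?thesis ..
  next
    case False
    then have "exhausts_to step D D" by (simp add: exhausts_to_def)
    then show ?thesis ..
  qed
qed

lemma finite_decision_tree: "finite (inner (decision_tree E r S))"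
proof -
  have "{p :: bool list. length p < card E} \<subseteq> {p. set p \<subseteq> UNIV \<and> length p \<le> card E}"
    by auto
  then show ?thesis
    using finite_subset[OF _ finite_lists_length_le[of "UNIV :: bool set" "card E"]]
    by (simp add: decision_tree_def)
qed

lemma inner_replace_node: "inner (replace_node v w D) = inner D - {v}"
  by (simp add: replace_node_def Let_def)

lemma bdd_step_inner: "bdd_step D D' \<Longrightarrow> \<exists>v \<in> inner D. inner D' = inner D - {v}"
  unfolding bdd_step_def
  by (elim disjE ns_step.cases bnd_step.cases) (hypsubst, rule bexI, rule inner_replace_node, assumption)+

lemma zdd_step_inner: "zdd_step D D' \<Longrightarrow> \<exists>v \<in> inner D. inner D' = inner D - {v}"
  unfolding zdd_step_def
  by (elim disjE ns_step.cases znd_step.cases) (hypsubst, rule bexI, rule inner_replace_node, assumption)+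

lemma exhausts_to_BDD: "exhausts_to bdd_step (decision_tree E r S) (BDD E r S)"
  unfolding BDD_def
  by (rule someI_ex, rule exhausts_to_exists[OF finite_decision_tree bdd_step_inner])

lemma exhausts_to_ZDD: "exhausts_to zdd_step (decision_tree E r S) (ZDD E r S)"
  unfolding ZDD_def
  by (rule someI_ex, rule exhausts_to_exists[OF finite_decision_tree zdd_step_inner])

end

theory Submission
  imports Defs
begin

text \<open>
  A decision diagram unfolds to a binary tree. Merging nodes does not change the unfolding of the
  root, and the deletion rules do not change its bottom-up normal form with respect to deletion.
  In an exhausted diagram distinct nodes have distinct unfoldings, which are normal; as moreover
  every node stays reachable, the diagram is determined up to isomorphism by the normal form of the
  complete decision tree.

  It remains to compare two normal forms. Suppose that some elements have been decided, let \<open>Q\<close> be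
  the set of those put into the dual independent set, and let \<open>P\<close> be a maximal independent subset of
  the other decided elements. Then the normal form of the remaining decision tree of the dual
  independent sets at \<open>Q\<close> is the mirror image of that of the bases at \<open>P\<close>. If the next element is
  spanned by \<open>P\<close>, both rules delete the node. Otherwise the two subtrees on the basis side agree
  only if both are empty, since bases are equicardinal, and by basis extension both are empty as
  soon as the one of the 1-arc is; hence again the two deletion rules apply simultaneously.
\<close>

section \<open>Binary trees and their normal forms\<close>

datatype 'a dtree = Leaf bool | Branch 'a "'a dtree" "'a dtree"

primrec mirror :: "'a dtree \<Rightarrow> 'a dtree" where
  "mirror (Leaf b) = Leaf b"
| "mirror (Branch a l r) = Branch a (mirror r) (mirror l)"

lemma mirror_mirror [simp]: "mirror (mirror t) = t"
  by (induction t) auto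

lemma mirror_eq_iff [simp]: "mirror s = mirror t \<longleftrightarrow> s = t"
  by (metis mirror_mirror)

text \<open>The test \<open>del\<close> sees children that are already normalized, as after
  exhaustive deletion below a node. Both deletion rules redirect to the 0-successor, so one function
  with the test as parameter serves BDDs and ZDDs.\<close>

primrec normalize :: "('a dtree \<Rightarrow> 'a dtree \<Rightarrow> bool) \<Rightarrow> 'a dtree \<Rightarrow> 'a dtree" where
  "normalize del (Leaf b) = Leaf b"
| "normalize del (Branch a l r) =
     (if del (normalize del l) (normalize del r) then normalize del l
      else Branch a (normalize del l) (normalize del r))"

abbreviation (input) bdd_del :: "'a dtree \<Rightarrow> 'a dtree \<Rightarrow> bool" where
  "bdd_del l r \<equiv> l = r"

abbreviation (input) zdd_del :: "'a dtree \<Rightarrow> 'a dtree \<Rightarrow> bool" where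
  "zdd_del l r \<equiv> r = Leaf False"

section \<open>Unfolding a diagram\<close>

text \<open>
  Since \<open>unfolds\<close> is inductive, a node has an unfolding only if no cycle can be reached from it.
\<close>

inductive unfolds :: "('v, 'a) diagram \<Rightarrow> 'v node \<Rightarrow> 'a dtree \<Rightarrow> bool" for D where
  unfolds_Bot: "unfolds D Bot (Leaf False)"
| unfolds_Top: "unfolds D Top (Leaf True)"
| unfolds_Inner: "\<lbrakk>v \<in> inner D; unfolds D (succ0 D v) l; unfolds D (succ1 D v) r\<rbrakk>
    \<Longrightarrow> unfolds D (Inner v) (Branch (lbl D v) l r)"

inductive_cases unfolds_BotE: "unfolds D Bot t"
inductive_cases unfolds_TopE: "unfolds D Top t"
inductive_cases unfolds_InnerE: "unfolds D (Inner v) t"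
inductive_cases unfolds_LeafE: "unfolds D x (Leaf b)"
inductive_cases unfolds_BranchE: "unfolds D x (Branch a l r)"

text \<open>An isomorphism must cover all of \<open>inner\<close>, while unfoldings only see what
  lies below the root; reachability closes this gap.\<close>

inductive reach :: "('v, 'a) diagram \<Rightarrow> 'v node \<Rightarrow> bool" for D where
  reach_start: "reach D (start D)"
| reach_succ0: "\<lbrakk>reach D (Inner v); v \<in> inner D\<rbrakk> \<Longrightarrow> reach D (succ0 D v)"
| reach_succ1: "\<lbrakk>reach D (Inner v); v \<in> inner D\<rbrakk> \<Longrightarrow> reach D (succ1 D v)"

lemma unfolds_unique: "unfolds D x s \<Longrightarrow> unfolds D x t \<Longrightarrow> s = t"
proof (induction arbitrary: t rule: unfolds.induct)
  case (unfolds_Inner v l r)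
  from unfolds_Inner.prems show ?case by (rule unfolds_InnerE) (simp add: unfolds_Inner.IH)
qed (auto elim: unfolds_BotE unfolds_TopE)

text \<open>Otherwise the unfolding would be a proper subtree of itself. Hence a deletion never
  redirects arcs to the deleted node.\<close>

lemma unfolds_not_self_loop:
  assumes "unfolds D (Inner v) t"
  shows "succ0 D v \<noteq> Inner v"
proof
  assume loop: "succ0 D v = Inner v"
  from assms obtain l r where "t = Branch (lbl D v) l r" "unfolds D (succ0 D v) l"
    by (auto elim: unfolds_InnerE)
  with loop assms have "t = Branch (lbl D v) t r"
    using unfolds_unique by metis
  then have "size t = size (Branch (lbl D v) t r)" by (rule arg_cong)
  then show False by simp
qed

lemma reach_unfolds:
  assumes "unfolds D (start D) t" "reach D x"
  shows "\<exists>s. unfolds D x s"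
  using assms(2)
proof induction
  case reach_start
  show ?case using assms(1) ..
qed (blast elim: unfolds_InnerE)+

section \<open>Invariants of the reduction\<close>

text \<open>A deletion may change the unfolding \<open>t\<close> of the root, so only its normal
  form \<open>n\<close> is fixed.\<close>

definition reduces_to_normal ::
  "('a dtree \<Rightarrow> 'a dtree \<Rightarrow> bool) \<Rightarrow> 'a dtree \<Rightarrow> ('v, 'a) diagram \<Rightarrow> bool" where
  "reduces_to_normal del n D \<longleftrightarrow>
     (\<exists>t. unfolds D (start D) t \<and> normalize del t = n) \<and> (\<forall>v \<in> inner D. reach D (Inner v))"

abbreviation redirect :: "'v \<Rightarrow> 'v node \<Rightarrow> 'v node \<Rightarrow> 'v node" where
  "redirect v w x \<equiv> if x = Inner v then w else x"

lemma replace_node_simps [simp]: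
  "inner (replace_node v w D) = inner D - {v}"
  "start (replace_node v w D) = redirect v w (start D)"
  "lbl (replace_node v w D) = lbl D"
  "succ0 (replace_node v w D) y = redirect v w (succ0 D y)"
  "succ1 (replace_node v w D) y = redirect v w (succ1 D y)"
  by (simp_all add: replace_node_def Let_def)

section \<open>Effect of a single step on unfoldings\<close>

lemma unfolds_Inner_replace:
  assumes "y \<in> inner D" "y \<noteq> v"
    and "unfolds (replace_node v w D) (redirect v w (succ0 D y)) l"
    and "unfolds (replace_node v w D) (redirect v w (succ1 D y)) r"
  shows "unfolds (replace_node v w D) (Inner y) (Branch (lbl D y) l r)"
  using unfolds_Inner[of y "replace_node v w D" l r] assms by simp

lemma ns_step_unfolds:
  assumes "u \<in> inner D" "u \<noteq> v" "lbl D u = lbl D v"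
    and "succ0 D u = succ0 D v" "succ1 D u = succ1 D v"
    and "unfolds D x t"
  shows "unfolds (replace_node v (Inner u) D) (redirect v (Inner u) x) t"
  using assms(6)
proof induction
  case (unfolds_Inner y l r)
  show ?case
  proof (cases "y = v")
    case True
    \<comment> \<open>The induction hypotheses concern the successors of \<open>v\<close>; these are
      also those of \<open>u\<close>, so the same tree grows at \<open>u\<close>.\<close>
    have "unfolds (replace_node v (Inner u) D) (Inner u) (Branch (lbl D u) l r)"
      by (rule unfolds_Inner_replace)
        (use unfolds_Inner.IH in \<open>simp_all only: True assms(1-5) not_False_eq_True\<close>)
    then show ?thesis using True assms(3) by simp
  next
    case False
    then show ?thesis
      using unfolds_Inner_replace[of y D v "Inner u" l r] unfolds_Inner by simp
  qed
qed (auto intro: unfolds.intros)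

lemma nd_step_unfolds:
  assumes loop: "succ0 D v \<noteq> Inner v"
    and del: "\<And>l r. unfolds D (succ0 D v) l \<Longrightarrow> unfolds D (succ1 D v) r
                \<Longrightarrow> del (normalize del l) (normalize del r)"
    and "unfolds D x t"
  shows "\<exists>t'. unfolds (replace_node v (succ0 D v) D) (redirect v (succ0 D v) x) t'
           \<and> normalize del t' = normalize del t"
  using assms(3)
proof induction
  case (unfolds_Inner y l r)
  from unfolds_Inner.IH obtain l' r' where
    l': "unfolds (replace_node v (succ0 D v) D) (redirect v (succ0 D v) (succ0 D y)) l'"
      "normalize del l' = normalize del l" and
    r': "unfolds (replace_node v (succ0 D v) D) (redirect v (succ0 D v) (succ1 D y)) r'"
      "normalize del r' = normalize del r"
    by blast
  show ?case
  proof (cases "y = v")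
    case True
    with del unfolds_Inner.hyps have "del (normalize del l) (normalize del r)" by simp
    \<comment> \<open>Arcs into \<open>v\<close> now lead to its 0-successor, which
      \<open>loop\<close> protects from redirection. So \<open>l'\<close> replaces the whole branch,
      whose normal form is that of \<open>l\<close> by the deletion test.\<close>
    with True l' loop show ?thesis by auto
  next
    case False
    with unfolds_Inner_replace[OF unfolds_Inner.hyps(1) _ l'(1) r'(1)] l' r' show ?thesis
      by (intro exI[of _ "Branch (lbl D y) l' r'"]) simp
  qed
qed (auto intro: unfolds.intros)

section \<open>Effect of a single step on reachability\<close>

lemma reach_succ_replace:
  assumes "reach (replace_node v w D) (Inner y)" "y \<in> inner D" "y \<noteq> v"
  shows "reach (replace_node v w D) (redirect v w (succ0 D y))"
    and "reach (replace_node v w D) (redirect v w (succ1 D y))"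
  using reach_succ0[OF assms(1)] reach_succ1[OF assms(1)] assms(2,3) by simp_all

lemma ns_step_reach:
  assumes "u \<in> inner D" "u \<noteq> v"
    and "succ0 D u = succ0 D v" "succ1 D u = succ1 D v"
    and "reach D x"
  shows "reach (replace_node v (Inner u) D) (redirect v (Inner u) x)"
  using assms(5)
proof induction
  case reach_start
  show ?case using reach.reach_start[of "replace_node v (Inner u) D"] by simp
next
  case (reach_succ0 y)
  have "reach (replace_node v (Inner u) D) (redirect v (Inner u) (succ0 D v))" if "y = v"
    using reach_succ_replace(1)[of v "Inner u" D u] reach_succ0.IH assms(1,2) that
    by (simp only: assms(3,4) simp_thms if_True)
  then show ?case
    using reach_succ_replace(1)[of v "Inner u" D y] reach_succ0 by (cases "y = v") auto
next
  case (reach_succ1 y)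
  have "reach (replace_node v (Inner u) D) (redirect v (Inner u) (succ1 D v))" if "y = v"
    using reach_succ_replace(2)[of v "Inner u" D u] reach_succ1.IH assms(1,2) that
    by (simp only: assms(3,4) simp_thms if_True)
  then show ?case
    using reach_succ_replace(2)[of v "Inner u" D y] reach_succ1 by (cases "y = v") auto
qed

text \<open>Deleting a node with 1-successor \<open>Bot\<close> can make \<open>Bot\<close> unreachable.\<close>

lemma nd_step_reach:
  assumes loop: "succ0 D v \<noteq> Inner v"
    and succ1: "succ1 D v = succ0 D v \<or> succ1 D v = Bot"
    and "reach D x"
  shows "reach (replace_node v (succ0 D v) D) (redirect v (succ0 D v) x)
           \<or> redirect v (succ0 D v) x = Bot"
  using assms(3)
proof induction
  case reach_start
  show ?case using reach.reach_start[of "replace_node v (succ0 D v) D"] by simp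
next
  case (reach_succ0 y)
  then show ?case
    using reach_succ_replace(1)[of v "succ0 D v" D y] loop by (cases "y = v") simp_all
next
  case (reach_succ1 y)
  show ?case
  proof (cases "y = v")
    case True
    \<comment> \<open>Either both successors of \<open>v\<close> coincide and the induction
      hypothesis already speaks of the redirected node, or the 1-successor is the exceptional
      \<open>Bot\<close>.\<close>
    with reach_succ1.IH succ1 loop show ?thesis by auto
  next
    case False
    with reach_succ1 show ?thesis using reach_succ_replace(2)[of v "succ0 D v" D y] by simp
  qed
qed

section \<open>Preservation of the invariant\<close>

lemma ns_step_reduces_to_normal:
  assumes "ns_step D D'" "reduces_to_normal del n D"
  shows "reduces_to_normal del n D'"
  using assms(1)
proof cases
  case (1 u v)
  from assms(2) obtain t where t: "unfolds D (start D) t" "normalize del t = n"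
    by (auto simp: reduces_to_normal_def)
  have "unfolds D' (start D') t"
    using ns_step_unfolds[of u D v, OF 1(2,4-7) t(1)] 1(1) by simp
  moreover have "reach D' (Inner y)" if "y \<in> inner D'" for y
  proof -
    from that 1(1) assms(2) have "reach D (Inner y)" "y \<noteq> v"
      by (auto simp: reduces_to_normal_def)
    then show ?thesis using ns_step_reach[of u D v "Inner y"] 1 by simp
  qed
  ultimately show ?thesis using t(2) by (auto simp: reduces_to_normal_def)
qed

lemma nd_step_reduces_to_normal:
  assumes "v \<in> inner D" "reduces_to_normal del n D"
    and del: "\<And>l r. unfolds D (succ0 D v) l \<Longrightarrow> unfolds D (succ1 D v) r
                \<Longrightarrow> del (normalize del l) (normalize del r)"
    and succ1: "succ1 D v = succ0 D v \<or> succ1 D v = Bot"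
  shows "reduces_to_normal del n (replace_node v (succ0 D v) D)"
proof -
  from assms(2) obtain t where t: "unfolds D (start D) t" "normalize del t = n"
    and reach: "\<And>y. y \<in> inner D \<Longrightarrow> reach D (Inner y)"
    by (auto simp: reduces_to_normal_def)
  from reach_unfolds[OF t(1) reach[OF assms(1)]] have loop: "succ0 D v \<noteq> Inner v"
    using unfolds_not_self_loop by metis
  let ?D' = "replace_node v (succ0 D v) D"
  have "\<exists>t'. unfolds ?D' (start ?D') t' \<and> normalize del t' = n"
    using nd_step_unfolds[of D v del, OF loop del t(1)] t(2) by simp
  moreover have "reach ?D' (Inner y)" if "y \<in> inner ?D'" for y
    using nd_step_reach[OF loop succ1 reach[of y]] that by auto
  ultimately show ?thesis by (auto simp: reduces_to_normal_def)
qed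

lemma bdd_step_reduces_to_normal:
  assumes "bdd_step D D'" "reduces_to_normal bdd_del n D"
  shows "reduces_to_normal bdd_del n D'"
  using assms(1) unfolding bdd_step_def
proof
  assume "ns_step D D'"
  then show ?thesis using assms(2) by (rule ns_step_reduces_to_normal)
next
  assume "bnd_step D D'"
  then show ?thesis
  proof cases
    case (1 v)
    show ?thesis unfolding 1(1)
    proof (rule nd_step_reduces_to_normal)
      fix l r assume "unfolds D (succ0 D v) l" "unfolds D (succ1 D v) r"
      then have "l = r" unfolding 1(3) by (rule unfolds_unique)
      then show "normalize bdd_del l = normalize bdd_del r" by simp
    qed (use 1 assms(2) in auto)
  qed
qed

lemma zdd_step_reduces_to_normal:
  assumes "zdd_step D D'" "reduces_to_normal zdd_del n D"
  shows "reduces_to_normal zdd_del n D'"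
  using assms(1) unfolding zdd_step_def
proof
  assume "ns_step D D'"
  then show ?thesis using assms(2) by (rule ns_step_reduces_to_normal)
next
  assume "znd_step D D'"
  then show ?thesis
  proof cases
    case (1 v)
    show ?thesis unfolding 1(1)
      by (rule nd_step_reduces_to_normal) (use 1 assms(2) in \<open>auto elim: unfolds_BotE\<close>)
  qed
qed

lemma rtranclp_invariant:
  assumes "R\<^sup>*\<^sup>* x y" "P x" "\<And>x y. R x y \<Longrightarrow> P x \<Longrightarrow> P y"
  shows "P y"
  using assms(1,2) by induction (auto intro: assms(3))

section \<open>Exhausted diagrams\<close>

text \<open>Terminals are included, so that equal subtrees force equal successors of whatever
  kind.\<close>

definition unfolds_inj :: "('v, 'a) diagram \<Rightarrow> bool" where
  "unfolds_inj D \<longleftrightarrow> (\<forall>x y t. unfolds D x t \<longrightarrow> unfolds D y t \<longrightarrow> x = y)"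

lemma unfolds_injD: "unfolds_inj D \<Longrightarrow> unfolds D x t \<Longrightarrow> unfolds D y t \<Longrightarrow> x = y"
  by (auto simp: unfolds_inj_def)

text \<open>By induction on the tree, nodes with equal unfoldings have equal labels and equal
  successors; if distinct, they could be merged.\<close>

lemma no_ns_step_unfolds_inj:
  assumes "\<nexists>D'. ns_step D D'"
  shows "unfolds_inj D"
proof -
  have "x = y" if "unfolds D x t" "unfolds D y t" for x y t
    using that
  proof (induction arbitrary: y rule: unfolds.induct)
    case (unfolds_Inner u l r)
    from unfolds_Inner.prems obtain v where v: "y = Inner v" "v \<in> inner D" "lbl D u = lbl D v"
      "unfolds D (succ0 D v) l" "unfolds D (succ1 D v) r"
      by (auto elim: unfolds_BranchE)
    then have "succ0 D u = succ0 D v" "succ1 D u = succ1 D v"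
      using unfolds_Inner.IH by auto
    with v unfolds_Inner.hyps(1) assms have "u = v"
      using ns_step.intros[of u D v] by blast
    with v show ?case by simp
  qed (auto elim: unfolds_LeafE)
  then show ?thesis by (auto simp: unfolds_inj_def)
qed

lemma normalize_unfolds:
  assumes "unfolds D x t"
    and "\<And>v l r. v \<in> inner D \<Longrightarrow> unfolds D (succ0 D v) l \<Longrightarrow> unfolds D (succ1 D v) r \<Longrightarrow> \<not> del l r"
  shows "normalize del t = t"
  using assms(1) by induction (use assms(2) in auto)

lemma exhausts_to_bdd_step:
  assumes "exhausts_to bdd_step D\<^sub>0 D" "reduces_to_normal bdd_del n D\<^sub>0"
  shows "unfolds D (start D) n" "unfolds_inj D" "\<And>v. v \<in> inner D \<Longrightarrow> reach D (Inner v)"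
proof -
  have steps: "bdd_step\<^sup>*\<^sup>* D\<^sub>0 D" and final: "\<nexists>D'. bdd_step D D'"
    using assms(1) by (auto simp: exhausts_to_def)
  have inv: "reduces_to_normal bdd_del n D"
    by (rule rtranclp_invariant[where P = "reduces_to_normal bdd_del n", OF steps assms(2)
          bdd_step_reduces_to_normal])
  show inj: "unfolds_inj D"
    using no_ns_step_unfolds_inj final by (auto simp: bdd_step_def)
  from inv obtain t where t: "unfolds D (start D) t" "normalize bdd_del t = n"
    by (auto simp: reduces_to_normal_def)
  have "normalize bdd_del t = t"
    using t(1)
  proof (rule normalize_unfolds)
    fix v l r
    assume "v \<in> inner D" "unfolds D (succ0 D v) l" "unfolds D (succ1 D v) r"
    \<comment> \<open>By injectivity, equal subtrees would mean equal successors, and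
      \<open>v\<close> could still be deleted.\<close>
    then show "l \<noteq> r"
      using unfolds_injD[OF inj] bnd_step.intros[of v D] final by (auto simp: bdd_step_def)
  qed
  with t show "unfolds D (start D) n" by simp
  show "reach D (Inner v)" if "v \<in> inner D" for v
    using inv that by (auto simp: reduces_to_normal_def)
qed

lemma exhausts_to_zdd_step:
  assumes "exhausts_to zdd_step D\<^sub>0 D" "reduces_to_normal zdd_del n D\<^sub>0"
  shows "unfolds D (start D) n" "unfolds_inj D" "\<And>v. v \<in> inner D \<Longrightarrow> reach D (Inner v)"
proof -
  have steps: "zdd_step\<^sup>*\<^sup>* D\<^sub>0 D" and final: "\<nexists>D'. zdd_step D D'"
    using assms(1) by (auto simp: exhausts_to_def)
  have inv: "reduces_to_normal zdd_del n D"
    by (rule rtranclp_invariant[where P = "reduces_to_normal zdd_del n", OF steps assms(2)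
          zdd_step_reduces_to_normal])
  show inj: "unfolds_inj D"
    using no_ns_step_unfolds_inj final by (auto simp: zdd_step_def)
  from inv obtain t where t: "unfolds D (start D) t" "normalize zdd_del t = n"
    by (auto simp: reduces_to_normal_def)
  have "normalize zdd_del t = t"
    using t(1)
  proof (rule normalize_unfolds)
    fix v l r
    assume "v \<in> inner D" "unfolds D (succ0 D v) l" "unfolds D (succ1 D v) r"
    \<comment> \<open>By injectivity, only \<open>Bot\<close> unfolds to \<open>Leaf False\<close>,
      and a 1-successor \<open>Bot\<close> would allow a deletion.\<close>
    then show "r \<noteq> Leaf False"
      using unfolds_injD[OF inj _ unfolds_Bot] znd_step.intros[of v D] final
      by (auto simp: zdd_step_def)
  qed
  with t show "unfolds D (start D) n" by simp
  show "reach D (Inner v)" if "v \<in> inner D" for v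
    using inv that by (auto simp: reduces_to_normal_def)
qed

section \<open>Isomorphism from equal unfoldings\<close>

text \<open>The path from the root to \<open>x\<close> can be followed in the other diagram, as the
  trees below stay equal at each step.\<close>

lemma reach_unfolds_matched:
  assumes "unfolds D (start D) t" "unfolds D' (start D') t" "reach D x"
  shows "\<exists>x' s. unfolds D x s \<and> unfolds D' x' s"
  using assms(3)
proof induction
  case reach_start
  show ?case using assms(1,2) by blast
next
  case (reach_succ0 v)
  then show ?case by (blast elim: unfolds_InnerE unfolds_BranchE)
next
  case (reach_succ1 v)
  then show ?case by (blast elim: unfolds_InnerE unfolds_BranchE)
qed

lemma unfolds_same_shape:
  assumes "unfolds D (Inner v) s" "unfolds D' x' s"
  obtains v' l r where "x' = Inner v'" "v' \<in> inner D'" "lbl D' v' = lbl D v"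
    and "unfolds D (succ0 D v) l" "unfolds D (succ1 D v) r"
    and "unfolds D' (succ0 D' v') l" "unfolds D' (succ1 D' v') r"
proof -
  from assms(1) obtain l r where s: "s = Branch (lbl D v) l r"
    "unfolds D (succ0 D v) l" "unfolds D (succ1 D v) r"
    by (auto elim: unfolds_InnerE)
  from assms(2)[unfolded s(1)] show thesis
    by (cases rule: unfolds.cases) (use s that in auto)
qed

text \<open>Each node is sent to the node of the other diagram with the same unfolding. Such a node
  exists by reachability and is unique by injectivity.\<close>

lemma diagram_iso_if_same_unfolding:
  assumes start: "unfolds D (start D) t" "unfolds D' (start D') t"
    and inj: "unfolds_inj D" "unfolds_inj D'"
    and reach: "\<And>v. v \<in> inner D \<Longrightarrow> reach D (Inner v)"
      "\<And>v. v \<in> inner D' \<Longrightarrow> reach D' (Inner v)"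
  shows "D \<simeq> D'"
proof -
  define f where
    "f v = (SOME v'. \<exists>s. unfolds D (Inner v) s \<and> unfolds D' (Inner v') s)" for v
  have f_eq: "f v = v'" if "unfolds D (Inner v) s" "unfolds D' (Inner v') s" for v v' s
    unfolding f_def
  proof (rule some_equality)
    show "w = v'" if "\<exists>s. unfolds D (Inner v) s \<and> unfolds D' (Inner w) s" for w
      using that \<open>unfolds D (Inner v) s\<close> \<open>unfolds D' (Inner v') s\<close>
        unfolds_unique unfolds_injD[OF inj(2)] by (metis node.inject)
  qed (use that in blast)
  have map_f: "x' = map_node f x" if "unfolds D x s" "unfolds D' x' s" for x x' s
  proof (cases x)
    case (Inner v)
    with that obtain v' where "x' = Inner v'" by (auto elim: unfolds_same_shape)
    with that Inner f_eq show ?thesis by auto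
  qed (use that in \<open>auto elim: unfolds_BotE unfolds_TopE unfolds_LeafE\<close>)
  have node: "f v \<in> inner D' \<and> (\<exists>s. unfolds D (Inner v) s \<and> unfolds D' (Inner (f v)) s) \<and>
      lbl D' (f v) = lbl D v \<and> succ0 D' (f v) = map_node f (succ0 D v) \<and>
      succ1 D' (f v) = map_node f (succ1 D v)" if "v \<in> inner D" for v
  proof -
    from reach_unfolds_matched[OF start reach(1)[OF that]] obtain x' s
      where s: "unfolds D (Inner v) s" "unfolds D' x' s" by blast
    from s obtain v' l r where v': "x' = Inner v'" "v' \<in> inner D'" "lbl D' v' = lbl D v"
      "unfolds D (succ0 D v) l" "unfolds D (succ1 D v) r"
      "unfolds D' (succ0 D' v') l" "unfolds D' (succ1 D' v') r"
      by (rule unfolds_same_shape)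
    moreover have "f v = v'" using f_eq s v'(1) by simp
    ultimately show ?thesis using s map_f[OF v'(4,6)] map_f[OF v'(5,7)] by auto
  qed
  have "inj_on f (inner D)"
  proof (rule inj_onI)
    fix u v assume "u \<in> inner D" "v \<in> inner D" "f u = f v"
    then show "u = v"
      using node[of u] node[of v] unfolds_unique unfolds_injD[OF inj(1)] by (metis node.inject)
  qed
  moreover have "f ` inner D = inner D'"
  proof
    show "f ` inner D \<subseteq> inner D'" using node by blast
    show "inner D' \<subseteq> f ` inner D"
    proof
      fix v' assume "v' \<in> inner D'"
      \<comment> \<open>Surjectivity uses the matching with the two diagrams exchanged.\<close>
      from reach_unfolds_matched[OF start(2,1) reach(2)[OF this]] obtain x s
        where s: "unfolds D' (Inner v') s" "unfolds D x s" by blast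
      then obtain v where "x = Inner v" "v \<in> inner D" by (rule unfolds_same_shape)
      with s f_eq show "v' \<in> f ` inner D" by blast
    qed
  qed
  ultimately have "bij_betw f (inner D) (inner D')" by (simp add: bij_betw_def)
  with node map_f[OF start] show ?thesis unfolding diagram_iso_def by (intro exI[of _ f]) simp
qed

section \<open>Swapping the arcs\<close>

lemma swap_arcs_simps [simp]:
  "inner (swap_arcs D) = inner D" "start (swap_arcs D) = start D" "lbl (swap_arcs D) = lbl D"
  "succ0 (swap_arcs D) = succ1 D" "succ1 (swap_arcs D) = succ0 D"
  by (simp_all add: swap_arcs_def)

lemma swap_arcs_swap_arcs [simp]: "swap_arcs (swap_arcs D) = D"
  by (simp add: swap_arcs_def)

lemma unfolds_swap_arcs:
  assumes "unfolds D x t"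
  shows "unfolds (swap_arcs D) x (mirror t)"
  using assms
proof induction
  case (unfolds_Inner v l r)
  then show ?case using unfolds.unfolds_Inner[of v "swap_arcs D" "mirror r" "mirror l"] by simp
qed (auto intro: unfolds.intros)

lemma unfolds_inj_swap_arcs:
  assumes "unfolds_inj D"
  shows "unfolds_inj (swap_arcs D)"
proof -
  have "unfolds D x (mirror t)" if "unfolds (swap_arcs D) x t" for x t
    using unfolds_swap_arcs[OF that] by simp
  then show ?thesis using assms unfolding unfolds_inj_def by blast
qed

lemma reach_swap_arcs:
  assumes "reach D x"
  shows "reach (swap_arcs D) x"
  using assms
proof induction
  case reach_start
  show ?case using reach.reach_start[of "swap_arcs D"] by simp
next
  case (reach_succ0 v)
  then show ?case using reach.reach_succ1[of "swap_arcs D" v] by simp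
next
  case (reach_succ1 v)
  then show ?case using reach.reach_succ0[of "swap_arcs D" v] by simp
qed

section \<open>The complete decision tree\<close>

text \<open>The accumulator \<open>P\<close> holds the elements taken so far, so every subtree is
  again a value of this function and induction on the remaining elements applies.\<close>

primrec family_tree :: "'a set set \<Rightarrow> 'a list \<Rightarrow> 'a set \<Rightarrow> 'a dtree" where
  "family_tree S [] P = Leaf (P \<in> S)"
| "family_tree S (x # xs) P = Branch x (family_tree S xs P) (family_tree S xs (insert x P))"

abbreviation ground_list :: "'a set \<Rightarrow> 'a rel \<Rightarrow> 'a list" where
  "ground_list E r \<equiv> map (nth_smallest E r) [0..<card E]"

lemma path_set_Nil: "path_set E r [] = {}"
  by (simp add: path_set_def)

lemma path_set_snoc:
  "path_set E r (p @ [b]) =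
     (if b then insert (nth_smallest E r (length p)) (path_set E r p) else path_set E r p)"
proof -
  have "{j. j < length (p @ [b]) \<and> (p @ [b]) ! j} =
      (if b then insert (length p) {j. j < length p \<and> p ! j} else {j. j < length p \<and> p ! j})"
    by (auto simp: nth_append less_Suc_eq)
  then show ?thesis by (simp add: path_set_def setcompr_eq_image)
qed

lemma decision_tree_simps [simp]:
  "inner (decision_tree E r S) = {p. length p < card E}"
  "start (decision_tree E r S) = tree_node E r S []"
  "lbl (decision_tree E r S) p = nth_smallest E r (length p)"
  "succ0 (decision_tree E r S) p = tree_node E r S (p @ [False])"
  "succ1 (decision_tree E r S) p = tree_node E r S (p @ [True])"
  by (simp_all add: decision_tree_def)

lemma unfolds_tree_node:
  assumes "length p \<le> card E"
  shows "unfolds (decision_tree E r S) (tree_node E r S p)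
           (family_tree S (drop (length p) (ground_list E r)) (path_set E r p))"
  using assms
\<comment> \<open>Children have longer paths, so the induction runs from the leaves towards the
  root.\<close>
proof (induction "card E - length p" arbitrary: p)
  case 0
  then have "length p = card E" by simp
  then show ?case by (simp add: tree_node_def unfolds_Bot unfolds_Top)
next
  case (Suc k)
  then have len: "length p < card E" by simp
  have drop: "drop (length p) (ground_list E r) =
      nth_smallest E r (length p) # drop (Suc (length p)) (ground_list E r)"
    using upt_conv_Cons[OF len] by (simp add: drop_map)
  have child: "unfolds (decision_tree E r S) (tree_node E r S (p @ [b]))
      (family_tree S (drop (Suc (length p)) (ground_list E r)) (path_set E r (p @ [b])))" for b
    using Suc.hyps(1)[of "p @ [b]"] Suc.hyps(2) len by simp
  have "unfolds (decision_tree E r S) (Inner p)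
      (Branch (lbl (decision_tree E r S) p)
        (family_tree S (drop (Suc (length p)) (ground_list E r)) (path_set E r (p @ [False])))
        (family_tree S (drop (Suc (length p)) (ground_list E r)) (path_set E r (p @ [True]))))"
    by (rule unfolds_Inner) (use len child in \<open>simp_all only: decision_tree_simps mem_Collect_eq\<close>)
  moreover have "tree_node E r S p = Inner p"
    using len by (simp add: tree_node_def)
  ultimately show ?case
    by (simp only: drop path_set_snoc family_tree.simps decision_tree_simps if_True if_False)
qed

lemma reach_tree_node:
  assumes "length p \<le> card E"
  shows "reach (decision_tree E r S) (tree_node E r S p)"
  using assms
proof (induction p rule: rev_induct)
  case Nil
  show ?case using reach_start[of "decision_tree E r S"] by simp
next
  case (snoc b p)
  then have "reach (decision_tree E r S) (Inner p)" "p \<in> inner (decision_tree E r S)"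
    by (simp_all add: tree_node_def)
  from reach_succ0[OF this] reach_succ1[OF this] show ?case by (cases b) simp_all
qed

lemma decision_tree_reduces_to_normal:
  "reduces_to_normal del (normalize del (family_tree S (ground_list E r) {})) (decision_tree E r S)"
  unfolding reduces_to_normal_def
proof (intro conjI ballI exI)
  show "unfolds (decision_tree E r S) (start (decision_tree E r S))
      (family_tree S (ground_list E r) {})"
    using unfolds_tree_node[of "[]" E r S] by (simp add: path_set_Nil)
next
  fix p assume "p \<in> inner (decision_tree E r S)"
  then show "reach (decision_tree E r S) (Inner p)"
    using reach_tree_node[of p E r S] by (simp add: tree_node_def)
qed simp

text \<open>Counting the strictly smaller elements is strictly monotone, hence injective, with
  values below \<open>card E\<close>; comparing cardinalities makes it bijective.
  \<open>nth_smallest\<close> is its inverse.\<close>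

lemma bij_betw_nth_smallest:
  assumes "finite E" "linear_order_on E r"
  shows "bij_betw (nth_smallest E r) {..<card E} E"
proof -
  define below where "below e = {x \<in> E. (x, e) \<in> r \<and> x \<noteq> e}" for e
  have tr: "trans r" and anti: "antisym r" and tot: "total_on E r"
    using assms(2) by (auto simp: linear_order_on_def partial_order_on_def preorder_on_def)
  have fin: "finite (below e)" for e using assms(1) by (simp add: below_def)
  have mono: "card (below x) < card (below y)"
    if "x \<in> E" "y \<in> E" "(x, y) \<in> r" "x \<noteq> y" for x y
  proof (rule psubset_card_mono[OF fin])
    have "below x \<subseteq> below y" "x \<in> below y" "x \<notin> below x"
      using that tr anti by (auto simp: below_def dest: transD antisymD)
    then show "below x \<subset> below y" by blast
  qed
  have inj: "inj_on (\<lambda>e. card (below e)) E"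
  proof (rule inj_onI)
    fix x y assume "x \<in> E" "y \<in> E" "card (below x) = card (below y)"
    then show "x = y" using mono[of x y] mono[of y x] tot by (auto simp: total_on_def)
  qed
  have "(\<lambda>e. card (below e)) ` E \<subseteq> {..<card E}"
  proof safe
    fix e assume "e \<in> E"
    then have "below e \<subset> E" by (auto simp: below_def)
    then show "card (below e) < card E" by (rule psubset_card_mono[OF assms(1)])
  qed
  then have "(\<lambda>e. card (below e)) ` E = {..<card E}"
    using card_image[OF inj] by (intro card_subset_eq) auto
  with inj have bij: "bij_betw (\<lambda>e. card (below e)) E {..<card E}" by (simp add: bij_betw_def)
  have "nth_smallest E r j = the_inv_into E (\<lambda>e. card (below e)) j" for j
    by (simp add: nth_smallest_def the_inv_into_def below_def)
  then show ?thesis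
    using bij_betw_the_inv_into[OF bij] by (metis bij_betw_cong)
qed

lemma ground_list:
  assumes "finite E" "linear_order_on E r"
  shows "distinct (ground_list E r)" "set (ground_list E r) = E"
  using bij_betw_nth_smallest[OF assms]
  by (auto simp: distinct_map bij_betw_def lessThan_atLeast0)

section \<open>ZDD semantics of binary trees\<close>

text \<open>Invariant under ZDD deletion, this set family serves to decide when a normal form on the
  basis side is empty and to extract a common member from two equal ones.\<close>

primrec zdd_family :: "'a dtree \<Rightarrow> 'a set set" where
  "zdd_family (Leaf b) = (if b then {{}} else {})"
| "zdd_family (Branch a l r) = zdd_family l \<union> insert a ` zdd_family r"

lemma zdd_family_normalize: "zdd_family (normalize zdd_del t) = zdd_family t"
proof (induction t)
  case (Branch a l r)
  then show ?case by (cases "normalize zdd_del r = Leaf False") auto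
qed simp

text \<open>Emptiness propagates upwards: once the 1-subtree has become \<open>Leaf False\<close>,
  the node gives way to its normalized 0-subtree.\<close>

lemma normalize_eq_Leaf_False_iff: "normalize zdd_del t = Leaf False \<longleftrightarrow> zdd_family t = {}"
  by (induction t) auto

lemma zdd_family_tree:
  assumes "distinct xs"
  shows "zdd_family (family_tree S xs P) = {X. X \<subseteq> set xs \<and> P \<union> X \<in> S}"
  using assms
proof (induction xs arbitrary: P)
  case (Cons x xs)
  have "{X. X \<subseteq> set (x # xs) \<and> P \<union> X \<in> S} =
      {X. X \<subseteq> set xs \<and> P \<union> X \<in> S} \<union> insert x ` {X. X \<subseteq> set xs \<and> insert x P \<union> X \<in> S}"
    (is "?A = ?B \<union> ?C")
  proof
    show "?A \<subseteq> ?B \<union> ?C"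
    proof
      fix X assume X: "X \<in> ?A"
      show "X \<in> ?B \<union> ?C"
      proof (cases "x \<in> X")
        case True
        then have "X = insert x (X - {x})" "insert x P \<union> (X - {x}) = P \<union> X" by auto
        with X have "X \<in> ?C" by (intro image_eqI[of _ _ "X - {x}"]) auto
        then show ?thesis ..
      qed (use X in auto)
    qed
  qed auto
  with Cons show ?case by simp
qed auto

section \<open>Matroids\<close>

context matroid
begin

section \<open>Equicardinality and extension of bases\<close>

lemma finite_basis: "B \<in> \<B> \<Longrightarrow> finite B"
  using bases_subset finite_ground by (auto intro: finite_subset)

text \<open>Exchanging elements of \<open>B1 - B2\<close> for elements of \<open>B2\<close> keeps
  the size and ends with a subset of \<open>B2\<close>.\<close>

lemma card_basis_le:
  assumes "B1 \<in> \<B>" "B2 \<in> \<B>"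
  shows "card B1 \<le> card B2"
  using assms(1)
proof (induction "card (B1 - B2)" arbitrary: B1 rule: less_induct)
  case less
  show ?case
  proof (cases "B1 \<subseteq> B2")
    case True
    then show ?thesis using card_mono finite_basis assms(2) by blast
  next
    case False
    then obtain x where x: "x \<in> B1 - B2" by blast
    with basis_exchange less.prems assms(2) obtain y
      where y: "y \<in> B2 - B1" "insert y (B1 - {x}) \<in> \<B>" by meson
    have "insert y (B1 - {x}) - B2 = (B1 - B2) - {x}" using y by auto
    then have "card (insert y (B1 - {x}) - B2) < card (B1 - B2)"
      using x finite_basis[OF less.prems] card_Diff1_less[of "B1 - B2" x] by simp
    with less.hyps y(2) have "card (insert y (B1 - {x})) \<le> card B2" by blast
    moreover have "card (insert y (B1 - {x})) = card B1"
      using x y finite_basis[OF less.prems] card_Suc_Diff1[of B1 x] by simp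
    ultimately show ?thesis by simp
  qed
qed

lemma card_basis_eq: "B1 \<in> \<B> \<Longrightarrow> B2 \<in> \<B> \<Longrightarrow> card B1 = card B2"
  by (simp add: card_basis_le le_antisym)

text \<open>Start from any basis containing \<open>I\<close> and exchange its elements outside
  \<open>I \<union> B\<close> for elements of \<open>B\<close>; those of \<open>I\<close> are never
  touched.\<close>

lemma basis_extension:
  assumes "I \<in> indep_sets \<B>" "B \<in> \<B>"
  shows "\<exists>B' \<in> \<B>. I \<subseteq> B' \<and> B' \<subseteq> I \<union> B"
proof -
  have "\<exists>B' \<in> \<B>. I \<subseteq> B' \<and> B' \<subseteq> I \<union> B" if "B1 \<in> \<B>" "I \<subseteq> B1" for B1
    using that
  proof (induction "card (B1 - (I \<union> B))" arbitrary: B1 rule: less_induct)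
    case less
    show ?case
    proof (cases "B1 \<subseteq> I \<union> B")
      case True
      with less.prems show ?thesis by blast
    next
      case False
      then obtain x where x: "x \<in> B1" "x \<notin> I" "x \<notin> B" by blast
      with basis_exchange[of B1 B x] less.prems(1) assms(2) obtain y
        where y: "y \<in> B - B1" "insert y (B1 - {x}) \<in> \<B>" by auto
      have "insert y (B1 - {x}) - (I \<union> B) = (B1 - (I \<union> B)) - {x}" using y by auto
      then have "card (insert y (B1 - {x}) - (I \<union> B)) < card (B1 - (I \<union> B))"
        using x finite_basis[OF less.prems(1)] card_Diff1_less[of "B1 - (I \<union> B)" x] by simp
      moreover have "I \<subseteq> insert y (B1 - {x})" using less.prems(2) x by auto
      ultimately show ?thesis using less.hyps y(2) by blast
    qed
  qed
  with assms(1) show ?thesis by (auto simp: indep_sets_def)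
qed

text \<open>Such a \<open>P\<close> is a basis of the restriction to \<open>Y\<close>. One-element
  extensions suffice as a test because independence passes to subsets.\<close>

definition maximal_indep_in :: "'a set \<Rightarrow> 'a set \<Rightarrow> bool" where
  "maximal_indep_in Y P \<longleftrightarrow>
     P \<in> indep_sets \<B> \<and> P \<subseteq> Y \<and> (\<forall>y \<in> Y - P. insert y P \<notin> indep_sets \<B>)"

lemma indep_sets_mono: "I \<in> indep_sets \<B> \<Longrightarrow> J \<subseteq> I \<Longrightarrow> J \<in> indep_sets \<B>"
  by (auto simp: indep_sets_def)

lemma maximal_indep_in_insert:
  assumes "maximal_indep_in Y P"
  shows "insert x P \<in> indep_sets \<B> \<Longrightarrow> maximal_indep_in (insert x Y) (insert x P)"
    and "insert x P \<notin> indep_sets \<B> \<Longrightarrow> maximal_indep_in (insert x Y) P"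
proof -
  assume "insert x P \<in> indep_sets \<B>"
  moreover have "insert y (insert x P) \<notin> indep_sets \<B>" if "y \<in> Y - P" for y
    using assms that indep_sets_mono[of "insert y (insert x P)" "insert y P"]
    by (auto simp: maximal_indep_in_def)
  ultimately show "maximal_indep_in (insert x Y) (insert x P)"
    using assms by (auto simp: maximal_indep_in_def)
qed (use assms in \<open>auto simp: maximal_indep_in_def\<close>)

text \<open>Extending \<open>P\<close> by elements of a basis inside \<open>Y\<close> stays inside
  \<open>Y\<close>, so maximality allows no new element and \<open>P\<close> is itself that
  extension.\<close>

lemma spanning_iff_maximal_indep_basis:
  assumes "maximal_indep_in Y P"
  shows "(\<exists>B \<in> \<B>. B \<subseteq> Y) \<longleftrightarrow> P \<in> \<B>"
proof
  assume "\<exists>B \<in> \<B>. B \<subseteq> Y"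
  then obtain B where B: "B \<in> \<B>" "B \<subseteq> Y" by blast
  with basis_extension assms obtain B' where B': "B' \<in> \<B>" "P \<subseteq> B'" "B' \<subseteq> P \<union> B"
    unfolding maximal_indep_in_def by meson
  have "B' \<subseteq> P"
  proof
    fix y assume y: "y \<in> B'"
    with B' have "insert y P \<in> indep_sets \<B>" by (auto simp: indep_sets_def)
    moreover have "y \<in> Y" using y B B' assms by (auto simp: maximal_indep_in_def)
    ultimately show "y \<in> P" using assms by (auto simp: maximal_indep_in_def)
  qed
  with B' show "P \<in> \<B>" by (simp add: subset_antisym)
next
  assume "P \<in> \<B>"
  with assms show "\<exists>B \<in> \<B>. B \<subseteq> Y" by (auto simp: maximal_indep_in_def)
qed

section \<open>Dual independence and the comparison of normal forms\<close>

lemma mem_indep_sets_dual_bases_iff: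
  assumes "Q \<subseteq> E"
  shows "Q \<in> indep_sets (dual_bases E \<B>) \<longleftrightarrow> (\<exists>B \<in> \<B>. B \<subseteq> E - Q)"
proof -
  have "Q \<subseteq> E - B \<longleftrightarrow> B \<subseteq> E - Q" if "B \<in> \<B>" for B
    using assms that bases_subset by auto
  moreover have "Q \<in> indep_sets (dual_bases E \<B>) \<longleftrightarrow> (\<exists>B \<in> \<B>. Q \<subseteq> E - B)"
    by (auto simp: indep_sets_def dual_bases_def)
  ultimately show ?thesis by blast
qed

lemma basis_subtrees_equal_iff:
  assumes "distinct (x # xs)" "x \<notin> P" "insert x P \<in> indep_sets \<B>"
  defines "l \<equiv> normalize zdd_del (family_tree \<B> xs P)"
    and "r \<equiv> normalize zdd_del (family_tree \<B> xs (insert x P))"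
  shows "l = r \<longleftrightarrow> r = Leaf False"
proof
  have fam_l: "zdd_family l = {X. X \<subseteq> set xs \<and> P \<union> X \<in> \<B>}"
    and fam_r: "zdd_family r = {X. X \<subseteq> set xs \<and> insert x P \<union> X \<in> \<B>}"
    using assms(1) by (simp_all add: l_def r_def zdd_family_normalize zdd_family_tree)
  have Leaf_l: "l = Leaf False \<longleftrightarrow> zdd_family l = {}"
    and Leaf_r: "r = Leaf False \<longleftrightarrow> zdd_family r = {}"
    unfolding l_def r_def by (simp_all add: zdd_family_normalize normalize_eq_Leaf_False_iff)
  {
    assume "l = r"
    show "r = Leaf False"
    proof (rule ccontr)
      assume "r \<noteq> Leaf False"
      then obtain X where X: "X \<in> zdd_family r" unfolding Leaf_r by blast
      \<comment> \<open>A set common to both families yields two bases that differ by the single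
        element \<open>x\<close>, against equicardinality.\<close>
      then have bases: "P \<union> X \<in> \<B>" "insert x (P \<union> X) \<in> \<B>" and "x \<notin> P \<union> X"
        using \<open>l = r\<close> fam_l fam_r assms(1,2) by auto
      then have "card (insert x (P \<union> X)) = Suc (card (P \<union> X))"
        using finite_basis[OF bases(1)] by simp
      then show False using card_basis_eq[OF bases] by simp
    qed
  next
    assume r: "r = Leaf False"
    have "zdd_family l = {}"
    proof (rule ccontr)
      assume "zdd_family l \<noteq> {}"
      then obtain X where X: "X \<subseteq> set xs" "P \<union> X \<in> \<B>" using fam_l by blast
      \<comment> \<open>A basis in the 0-subtree can be traded for one through \<open>x\<close>
        within the undecided elements, which would lie in the 1-subtree.\<close>
      from basis_extension[OF assms(3) X(2)] obtain B'
        where B': "B' \<in> \<B>" "insert x P \<subseteq> B'" "B' \<subseteq> insert x P \<union> (P \<union> X)" by blast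
      then have "insert x P \<union> (B' - insert x P) = B'" "B' - insert x P \<subseteq> set xs"
        using X(1) by auto
      with B'(1) have "B' - insert x P \<in> zdd_family r" unfolding fam_r by (simp only: mem_Collect_eq)
      with r show False by simp
    qed
    with r Leaf_l show "l = r" by simp
  }
qed

text \<open>\<open>E - set xs - Q\<close> consists of the decided elements left out of
  \<open>Q\<close>. At a leaf, \<open>Q\<close> is dual independent iff this set contains a basis,
  that is, iff \<open>P\<close> is one.\<close>

lemma normal_form_dual_indep_sets:
  assumes "distinct xs" "set xs \<subseteq> E" "Q \<subseteq> E - set xs" "maximal_indep_in (E - set xs - Q) P"
  shows "normalize bdd_del (family_tree (indep_sets (dual_bases E \<B>)) xs Q) =
         mirror (normalize zdd_del (family_tree \<B> xs P))"
  using assms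
proof (induction xs arbitrary: Q P)
  case Nil
  then show ?case
    using mem_indep_sets_dual_bases_iff[of Q] spanning_iff_maximal_indep_basis[of "E - Q" P] by simp
next
  case (Cons x xs)
  let ?b = "\<lambda>Q. normalize bdd_del (family_tree (indep_sets (dual_bases E \<B>)) xs Q)"
  let ?z = "\<lambda>P. normalize zdd_del (family_tree \<B> xs P)"
  have xs: "distinct xs" "set xs \<subseteq> E" "Q \<subseteq> E - set xs" "insert x Q \<subseteq> E - set xs"
    using Cons.prems(1-3) by auto
  have Y: "E - set xs - insert x Q = E - set (x # xs) - Q"
    "E - set xs - Q = insert x (E - set (x # xs) - Q)"
    using Cons.prems(1-3) by auto
  have "x \<notin> P"
    using Cons.prems(4) by (auto simp: maximal_indep_in_def)
  \<comment> \<open>Putting \<open>x\<close> into \<open>Q\<close> leaves the decided rest, and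
    hence \<open>P\<close>, unchanged: the dual 1-arc corresponds to the 0-arc for bases.\<close>
  have one: "?b (insert x Q) = mirror (?z P)"
    by (rule Cons.IH) (rule xs | simp only: Y(1) Cons.prems(4))+
  show ?case
  proof (cases "insert x P \<in> indep_sets \<B>")
    case True
    \<comment> \<open>Leaving \<open>x\<close> out of \<open>Q\<close> adds it to the decided rest,
      where \<open>P\<close> must grow by \<open>x\<close>: the dual 0-arc corresponds to the 1-arc
      for bases.\<close>
    have zero: "?b Q = mirror (?z (insert x P))"
      by (rule Cons.IH)
        (rule xs | simp only: Y(2) maximal_indep_in_insert(1)[OF Cons.prems(4) True])+
    note equal_iff = basis_subtrees_equal_iff[OF Cons.prems(1) \<open>x \<notin> P\<close> True]
    show ?thesis
    proof (cases "?z (insert x P) = Leaf False")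
      case True
      with equal_iff have "?z P = Leaf False" by metis
      with True zero one show ?thesis by simp
    next
      case False
      with equal_iff have "?z P \<noteq> ?z (insert x P)" by metis
      with False zero one show ?thesis by simp
    qed
  next
    case False
    \<comment> \<open>Here \<open>P\<close> spans \<open>x\<close> and remains maximal, so both dual
      subtrees equal \<open>mirror (?z P)\<close> and the BDD rule deletes the node.\<close>
    have "?b Q = mirror (?z P)"
      by (rule Cons.IH)
        (rule xs | simp only: Y(2) maximal_indep_in_insert(2)[OF Cons.prems(4) False])+
    moreover have "?z (insert x P) = Leaf False"
    proof -
      have "insert x P \<union> X \<notin> \<B>" for X
        using False unfolding indep_sets_def by blast
      then show ?thesis
        using xs(1) by (simp add: normalize_eq_Leaf_False_iff zdd_family_tree)
    qed
    ultimately show ?thesis using one by simp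
  qed
qed

end

theorem theorem3p6:
  fixes E :: "'a set" and \<B> :: "'a set set" and r :: "'a rel"
  assumes "matroid E \<B>" and "linear_order_on E r"
  shows "BDD E r (indep_sets (dual_bases E \<B>)) \<simeq> swap_arcs (ZDD E r \<B>)"
proof -
  interpret matroid E \<B> by (rule assms(1))
  note ground = ground_list[OF finite_ground assms(2)]
  \<comment> \<open>At the root nothing is decided, so both \<open>Q\<close> and \<open>P\<close>
    start empty.\<close>
  have "maximal_indep_in {} {}"
    using bases_nonempty by (auto simp: maximal_indep_in_def indep_sets_def)
  then have normal: "normalize bdd_del (family_tree (indep_sets (dual_bases E \<B>)) (ground_list E r) {}) =
      mirror (normalize zdd_del (family_tree \<B> (ground_list E r) {}))"
    using ground by (intro normal_form_dual_indep_sets) (simp_all del: set_map)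
  note bdd = exhausts_to_bdd_step[OF exhausts_to_BDD decision_tree_reduces_to_normal]
  note zdd = exhausts_to_zdd_step[OF exhausts_to_ZDD decision_tree_reduces_to_normal]
  show ?thesis
  proof (rule diagram_iso_if_same_unfolding)
    show "unfolds (BDD E r (indep_sets (dual_bases E \<B>)))
        (start (BDD E r (indep_sets (dual_bases E \<B>))))
        (mirror (normalize zdd_del (family_tree \<B> (ground_list E r) {})))"
      using bdd(1) normal by metis
    show "unfolds (swap_arcs (ZDD E r \<B>)) (start (swap_arcs (ZDD E r \<B>)))
        (mirror (normalize zdd_del (family_tree \<B> (ground_list E r) {})))"
      using unfolds_swap_arcs[OF zdd(1)] by simp
    show "reach (swap_arcs (ZDD E r \<B>)) (Inner v)" if "v \<in> inner (swap_arcs (ZDD E r \<B>))" for v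
      using that by (intro reach_swap_arcs zdd(3)) simp
  qed (rule bdd(2) bdd(3) unfolds_inj_swap_arcs[OF zdd(2)] | assumption)+
qed

end
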